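(* Let $P\subset\mathbb{R}^2$ be a finite set of $n$ points with no four collinear, enumerated as $p_1,\dots,p_n$ in increasing order of their orthogonal projections onto a fixed line $L$ onto which the points of $P$ have pairwise distinct projections. Then for every positive integer $K$ with $2K\le n$, $$\overline{\mathcal{Q}}_{2K}\le \mathcal{Q}_K .$$
   Context: Two distinct points $p,q\in P$ are visible in $P$ if the open line segment joining them contains no point of $P$. The visibility graph $\mathcal{V}_P$ has vertex set $P$, with two distinct vertices adjacent if and only if they are visible in $P$. The line $L$ is a fixed non-vertical line such that the orthogonal projection $\pi$ of $P$ onto $L$ gives $|P|$ distinct points, and the enumeration satisfies $\pi(p_1)<\pi(p_2)<\cdots<\pi(p_n)$ with respect to the linear order along $L$. For $1\le r\le n$ and $1\le s\le n-r+1$, let $J_r(s)=\{p_s,p_{s+1},\ldots,p_{s+r-1}\}$, and let $\mathcal{V}_P[J_r(s)]$ be the subgraph of $\mathcal{V}_P$ induced on $J_r(s)$. Define $$\mathcal{Q}_r=\sum_{s=1}^{n-r+1}|E(\mathcal{V}_P[J_r(s)])|,\qquad \overline{\mathcal{Q}}_r=\sum_{s=1}^{n-r+1}\left(\binom{r}{2}-|E(\mathcal{V}_P[J_r(s)])|\right).$$ *)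

theory Defs
  imports "HOL-Analysis.Analysis"
begin

type_synonym 'a graph = "'a set \<times> 'a set set"

abbreviation vertices :: "'a graph \<Rightarrow> 'a set" where
  "vertices G \<equiv> fst G"

abbreviation edges :: "'a graph \<Rightarrow> 'a set set" where
  "edges G \<equiv> snd G"

definition induced_subgraph :: "'a graph \<Rightarrow> 'a set \<Rightarrow> 'a graph" where
  "induced_subgraph G J = (vertices G \<inter> J, {e \<in> edges G. e \<subseteq> J})"

definition visible :: "(real^2) set \<Rightarrow> real^2 \<Rightarrow> real^2 \<Rightarrow> bool" where
  "visible P x y \<longleftrightarrow> x \<in> P \<and> y \<in> P \<and> x \<noteq> y \<and> open_segment x y \<inter> P = {}"

definition visibility_graph :: "(real^2) set \<Rightarrow> (real^2) graph" where
  "visibility_graph P = (P, {{x, y} | x y. visible P x y})"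

definition no_four_collinear :: "(real^2) set \<Rightarrow> bool" where
  "no_four_collinear P \<longleftrightarrow> (\<forall>S\<subseteq>P. card S = 4 \<longrightarrow> \<not> collinear S)"

definition nonvertical_line :: "(real^2) set \<Rightarrow> bool" where
  "nonvertical_line L \<longleftrightarrow> affine L \<and> aff_dim L = 1 \<and> (\<exists>u\<in>L. \<exists>v\<in>L. u$1 \<noteq> v$1)"

text \<open>
  Since a non-vertical line \<open>L\<close> meets every vertical line in exactly one point, its left-to-right
  linear order is the order of first coordinates. The orthogonal projection onto the closed
  convex set \<open>L\<close> is \<open>closest_point L\<close>. The enumeration \<open>p\<close> is 1-based; its values outside
  \<open>{1..card P}\<close> are irrelevant.
\<close>
definition enumerates_along ::
    "(real^2) set \<Rightarrow> (real^2) set \<Rightarrow> (nat \<Rightarrow> real^2) \<Rightarrow> bool" where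
  "enumerates_along L P p \<longleftrightarrow>
     bij_betw p {1..card P} P \<and>
     (\<forall>i\<in>{1..card P}. \<forall>j\<in>{1..card P}.
        i < j \<longrightarrow> closest_point L (p i) $ 1 < closest_point L (p j) $ 1)"

definition window :: "(nat \<Rightarrow> real^2) \<Rightarrow> nat \<Rightarrow> nat \<Rightarrow> (real^2) set" where
  "window p r s = p ` {s..<s + r}"

definition window_edges ::
    "(real^2) set \<Rightarrow> (nat \<Rightarrow> real^2) \<Rightarrow> nat \<Rightarrow> nat \<Rightarrow> nat" where
  "window_edges P p r s =
     card (edges (induced_subgraph (visibility_graph P) (window p r s)))"

text \<open>
  In the two sums below \<open>1 \<le> r \<le> card P\<close> is intended, so that the upper summation bound is
  not affected by truncated subtraction. The second one is integer-valued so that the subtraction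
  in its summand is not truncated.
\<close>
definition Q :: "(real^2) set \<Rightarrow> (nat \<Rightarrow> real^2) \<Rightarrow> nat \<Rightarrow> nat" where
  "Q P p r = (\<Sum>s = 1..card P - r + 1. window_edges P p r s)"

definition Q_bar :: "(real^2) set \<Rightarrow> (nat \<Rightarrow> real^2) \<Rightarrow> nat \<Rightarrow> int" where
  "Q_bar P p r = (\<Sum>s = 1..card P - r + 1. int (r choose 2) - int (window_edges P p r s))"

end

theory Submission
  imports Defs
begin

text \<open>
  Cut a window of length \<open>2K\<close> into two halves of length \<open>K\<close>. If \<open>p i\<close> and \<open>p j\<close> lie in the window
  and do not see each other, then, as no four points are collinear, exactly one point \<open>p m\<close> blocks
  them; it satisfies \<open>i < m < j\<close> and sees both. One of the pairs \<open>(i, m)\<close>, \<open>(m, j)\<close> lies in one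
  half: the first one in the left half, or else the second one in the right half. The assignment of
  this visible pair and its half to the invisible pair and its window is injective, because the line
  through a visible pair contains at most one further point.
\<close>

section \<open>Orthogonal projection onto an affine set\<close>

text \<open>The obtuse-angle inequality at the nearest point holds for \<open>w\<close> and for the
  reflection of \<open>w\<close> through that point, which also lies in \<open>L\<close>; the two
  have opposite signs.\<close>

lemma closest_point_affine_orthogonal:
  fixes L :: "'a::euclidean_space set"
  assumes "affine L" "w \<in> L"
  shows "(x - closest_point L x) \<bullet> (w - closest_point L x) = 0"
proof -
  let ?q = "closest_point L x"
  have cl: "closed L" and cv: "convex L"
    using assms(1) by (auto simp: affine_closed affine_imp_convex)
  have q: "?q \<in> L" using cl assms(2) by (auto intro: closest_point_in_set)
  have "2 *\<^sub>R ?q + (-1) *\<^sub>R w \<in> L"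
    using assms q unfolding affine_def by (metis add.commute add_uminus_conv_diff diff_add_cancel one_add_one)
  then have "(x - ?q) \<bullet> (2 *\<^sub>R ?q + (-1) *\<^sub>R w - ?q) \<le> 0"
    by (rule closest_point_dot[OF cv cl])
  moreover have "2 *\<^sub>R ?q + (-1) *\<^sub>R w - ?q = - (w - ?q)"
    by (simp add: scaleR_2)
  moreover have "(x - ?q) \<bullet> (w - ?q) \<le> 0"
    by (rule closest_point_dot[OF cv cl assms(2)])
  ultimately show ?thesis by (simp only: inner_minus_right)
qed

text \<open>Residuals are orthogonal to differences of points of \<open>L\<close>, so the difference
  of the two sides is orthogonal to itself.\<close>

lemma closest_point_affine_combination:
  fixes L :: "'a::euclidean_space set"
  assumes "affine L" "L \<noteq> {}"
  shows "closest_point L ((1 - u) *\<^sub>R x + u *\<^sub>R y) =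
    (1 - u) *\<^sub>R closest_point L x + u *\<^sub>R closest_point L y"
proof -
  let ?c = "closest_point L"
  define z where "z = (1 - u) *\<^sub>R x + u *\<^sub>R y"
  define q where "q = (1 - u) *\<^sub>R ?c x + u *\<^sub>R ?c y"
  have cl: "closed L" and cv: "convex L"
    using assms(1) by (auto simp: affine_closed affine_imp_convex)
  have cx: "?c x \<in> L" and cy: "?c y \<in> L" and cz: "?c z \<in> L"
    using cl assms(2) by (auto intro: closest_point_in_set)
  have q: "q \<in> L" using assms(1) cx cy by (simp add: affine_def q_def)
  have orth: "(v - ?c v) \<bullet> (?c z - q) = 0" for v
    using closest_point_affine_orthogonal[OF assms(1) cz, of v]
      closest_point_affine_orthogonal[OF assms(1) q, of v]
    by (simp add: inner_diff_right)
  have "z - q = (1 - u) *\<^sub>R (x - ?c x) + u *\<^sub>R (y - ?c y)"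
    by (simp add: z_def q_def algebra_simps)
  then have "(z - q) \<bullet> (?c z - q) = 0"
    by (simp add: inner_add_left orth)
  with orth[of z] have "(?c z - q) \<bullet> (?c z - q) = 0"
    by (simp add: inner_diff_left)
  then show ?thesis by (simp add: z_def q_def)
qed

text \<open>The projection interpolates affinely along a segment. This will place a blocker strictly
  between its endpoints in the enumeration.\<close>

lemma closest_point_open_segment_less:
  fixes L :: "(real^'n) set"
  assumes "affine L" "L \<noteq> {}" "z \<in> open_segment x y"
    and "closest_point L x $ k < closest_point L y $ k"
  shows "closest_point L x $ k < closest_point L z $ k"
    and "closest_point L z $ k < closest_point L y $ k"
proof -
  obtain u where u: "0 < u" "u < 1" and z: "z = (1 - u) *\<^sub>R x + u *\<^sub>R y"
    using assms(3) by (auto simp: in_segment)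
  let ?a = "closest_point L x $ k" and ?b = "closest_point L y $ k"
  have c: "closest_point L z $ k = (1 - u) * ?a + u * ?b"
    by (simp add: z closest_point_affine_combination[OF assms(1,2)])
  have "0 < u * (?b - ?a)" "0 < (1 - u) * (?b - ?a)"
    using u assms(4) by (intro mult_pos_pos; simp)+
  then show "?a < closest_point L z $ k" "closest_point L z $ k < ?b"
    by (auto simp: c algebra_simps)
qed

section \<open>Lines through points of \<open>P\<close>\<close>

text \<open>Otherwise the two triples, sharing the distinct points \<open>a\<close> and
  \<open>b\<close>, would put four points of \<open>P\<close> on one line.\<close>

lemma no_four_collinear_third_unique:
  assumes "no_four_collinear P" "{a, b, c, d} \<subseteq> P" "a \<noteq> b"
    and "c \<notin> {a, b}" "d \<notin> {a, b}" "collinear {a, b, c}" "collinear {a, b, d}"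
  shows "c = d"
proof (rule ccontr)
  assume "c \<noteq> d"
  then have "card {a, b, c, d} = 4" using assms(3-5) by auto
  moreover have "collinear {a, b, c, d}" using assms(3,6,7) collinear_4_3 by blast
  ultimately show False using assms(1,2) unfolding no_four_collinear_def by blast
qed

lemma open_segment_collinear:
  fixes x y z :: "'a::euclidean_space"
  assumes "z \<in> open_segment x y"
  shows "collinear {x, z, y}"
proof -
  have "between (x, y) z"
    using assms by (simp add: between_mem_segment open_segment_def)
  then show ?thesis by (rule between_imp_collinear)
qed

lemma visible_commute: "visible P x y \<longleftrightarrow> visible P y x"
  by (auto simp: visible_def open_segment_commute)

text \<open>A point of \<open>P\<close> between \<open>x\<close> and \<open>z\<close> is a third
  point on their line, as is \<open>y\<close>, so it equals \<open>y\<close>; but then each of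
  \<open>y\<close> and \<open>z\<close> would be nearer to \<open>x\<close> than the other.\<close>

lemma visible_blocking_point:
  assumes "no_four_collinear P" "x \<in> P" "y \<in> P" "z \<in> P" "z \<in> open_segment x y"
  shows "visible P x z"
proof -
  have xy: "x \<noteq> y" and zx: "z \<noteq> x" and zy: "z \<noteq> y"
    using assms(5) by (auto simp: open_segment_def)
  have "w \<notin> P" if w: "w \<in> open_segment x z" for w
  proof
    assume "w \<in> P"
    have wx: "w \<noteq> x" "w \<noteq> z" using w by (auto simp: open_segment_def)
    have "collinear {x, z, w}" using open_segment_collinear[OF w] by (simp add: insert_commute)
    then have "w = y"
      using no_four_collinear_third_unique[OF assms(1), of x z w y]
        open_segment_collinear[OF assms(5)] \<open>w \<in> P\<close> assms(2-4) wx xy zx zy by auto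
    then have "dist x y < dist x z" "dist x z < dist x y"
      using dist_in_open_segment[OF w] dist_in_open_segment[OF assms(5)]
      by (auto simp: dist_commute)
    then show False by simp
  qed
  then show ?thesis using assms(2,4) zx by (auto simp: visible_def)
qed

section \<open>Counting by increasing index pairs\<close>

definition visible_pairs ::
    "(real^2) set \<Rightarrow> (nat \<Rightarrow> real^2) \<Rightarrow> nat \<Rightarrow> nat \<Rightarrow> (nat \<times> nat) set" where
  "visible_pairs P p r s = {(i, j). s \<le> i \<and> i < j \<and> j < s + r \<and> visible P (p i) (p j)}"

definition invisible_pairs ::
    "(real^2) set \<Rightarrow> (nat \<Rightarrow> real^2) \<Rightarrow> nat \<Rightarrow> nat \<Rightarrow> (nat \<times> nat) set" where
  "invisible_pairs P p r s = {(i, j). s \<le> i \<and> i < j \<and> j < s + r \<and> \<not> visible P (p i) (p j)}"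

lemma finite_visible_pairs [simp]: "finite (visible_pairs P p r s)"
  by (rule finite_subset[of _ "{..<s + r} \<times> {..<s + r}"]) (auto simp: visible_pairs_def)

lemma finite_invisible_pairs [simp]: "finite (invisible_pairs P p r s)"
  by (rule finite_subset[of _ "{..<s + r} \<times> {..<s + r}"]) (auto simp: invisible_pairs_def)

text \<open>As \<open>p\<close> is injective on \<open>A\<close>, each doubleton comes from exactly
  one increasing index pair. This serves for window edges and, with \<open>p = id\<close>, for a
  binomial coefficient.\<close>

lemma card_doubletons_eq_card_ordered_pairs:
  fixes A :: "'b::linorder set"
  assumes "inj_on p A" and E: "\<And>e. e \<in> E \<Longrightarrow> e \<subseteq> p ` A \<and> card e = 2"
  shows "card E = card {(i, j). i \<in> A \<and> j \<in> A \<and> i < j \<and> {p i, p j} \<in> E}"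
proof -
  let ?S = "{(i, j). i \<in> A \<and> j \<in> A \<and> i < j \<and> {p i, p j} \<in> E}"
  have "inj_on (\<lambda>(i, j). {p i, p j}) ?S"
  proof (rule inj_onI, clarify)
    fix i j i' j'
    assume A: "i \<in> A" "j \<in> A" "i' \<in> A" "j' \<in> A"
      and less: "i < j" "i' < j'" and eq: "{p i, p j} = {p i', p j'}"
    have "i = i' \<and> j = j' \<or> i = j' \<and> j = i'"
      using eq A inj_on_eq_iff[OF assms(1)] by (simp add: doubleton_eq_iff)
    then show "i = i' \<and> j = j'" using less by auto
  qed
  moreover have "(\<lambda>(i, j). {p i, p j}) ` ?S = E"
  proof
    show "E \<subseteq> (\<lambda>(i, j). {p i, p j}) ` ?S"
    proof
      fix e assume e: "e \<in> E"
      obtain x y where xy: "e = {x, y}" "x \<noteq> y" using E[OF e] unfolding card_2_iff by blast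
      then obtain a b where ab: "a \<in> A" "b \<in> A" "x = p a" "y = p b" using E[OF e] by auto
      have "a < b \<or> b < a" using ab xy by (metis neq_iff)
      then show "e \<in> (\<lambda>(i, j). {p i, p j}) ` ?S"
      proof
        assume "a < b"
        then have "(a, b) \<in> ?S" using ab xy e by auto
        then show ?thesis using ab xy by force
      next
        assume "b < a"
        then have "(b, a) \<in> ?S" using ab xy e by (auto simp: insert_commute)
        then show ?thesis using ab xy by force
      qed
    qed
  qed auto
  ultimately have "bij_betw (\<lambda>(i, j). {p i, p j}) ?S E" by (rule bij_betw_imageI)
  from bij_betw_same_card[OF this] show ?thesis by (rule sym)
qed

lemma window_edges_eq_card:
  assumes "inj_on p {s..<s + r}"
  shows "window_edges P p r s = card (visible_pairs P p r s)"
proof -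
  let ?E = "edges (induced_subgraph (visibility_graph P) (window p r s))"
  have mem: "{x, y} \<in> ?E \<longleftrightarrow> visible P x y \<and> {x, y} \<subseteq> p ` {s..<s + r}" for x y
    by (auto simp: induced_subgraph_def visibility_graph_def window_def doubleton_eq_iff
        visible_commute)
  have "card ?E = card {(i, j). i \<in> {s..<s + r} \<and> j \<in> {s..<s + r} \<and> i < j \<and> {p i, p j} \<in> ?E}"
    by (rule card_doubletons_eq_card_ordered_pairs[OF assms])
      (auto simp: induced_subgraph_def visibility_graph_def window_def visible_def card_2_iff)
  also have "{(i, j). i \<in> {s..<s + r} \<and> j \<in> {s..<s + r} \<and> i < j \<and> {p i, p j} \<in> ?E} =
      visible_pairs P p r s"
    by (auto simp: mem visible_pairs_def)
  finally show ?thesis by (simp add: window_edges_def)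
qed

text \<open>The offset \<open>s\<close> is free, so that the count fits the window starting at
  \<open>s\<close>.\<close>

lemma choose_two_eq_card_ordered_pairs:
  "r choose 2 = card {(i, j). s \<le> i \<and> i < j \<and> j < s + (r::nat)}"
proof -
  let ?E = "{e. e \<subseteq> {s..<s + r} \<and> card e = 2}"
  have "r choose 2 = card ?E" by (simp add: n_subsets)
  also have "\<dots> = card {(i, j). i \<in> {s..<s + r} \<and> j \<in> {s..<s + r} \<and> i < j \<and> {id i, id j} \<in> ?E}"
    by (rule card_doubletons_eq_card_ordered_pairs) auto
  also have "{(i, j). i \<in> {s..<s + r} \<and> j \<in> {s..<s + r} \<and> i < j \<and> {id i, id j} \<in> ?E} =
      {(i, j). s \<le> i \<and> i < j \<and> j < s + r}"
    by auto
  finally show ?thesis .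
qed

lemma card_invisible_pairs:
  "int (card (invisible_pairs P p r s)) = int (r choose 2) - int (card (visible_pairs P p r s))"
proof -
  have "{(i, j). s \<le> i \<and> i < j \<and> j < s + r} = visible_pairs P p r s \<union> invisible_pairs P p r s"
    by (auto simp: visible_pairs_def invisible_pairs_def)
  moreover have "visible_pairs P p r s \<inter> invisible_pairs P p r s = {}"
    by (auto simp: visible_pairs_def invisible_pairs_def)
  ultimately show ?thesis
    by (simp add: choose_two_eq_card_ordered_pairs[of r s] card_Un_disjoint)
qed

section \<open>From invisible pairs to visible pairs\<close>

text \<open>A blocker projects strictly between the endpoints, and the enumeration is monotone along
  \<open>L\<close>. Hence it lies in every window containing both endpoints.\<close>

lemma ex_blocking_index:
  assumes "nonvertical_line L" "enumerates_along L P p"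
    and "i \<in> {1..card P}" "j \<in> {1..card P}" "i < j" "\<not> visible P (p i) (p j)"
  shows "\<exists>m. i < m \<and> m < j \<and> p m \<in> open_segment (p i) (p j)"
proof -
  let ?c = "\<lambda>i. closest_point L (p i) $ 1"
  have L: "affine L" "L \<noteq> {}" using assms(1) by (auto simp: nonvertical_line_def)
  have bij: "bij_betw p {1..card P} P"
    and mono: "\<And>i j. i \<in> {1..card P} \<Longrightarrow> j \<in> {1..card P} \<Longrightarrow> i < j \<Longrightarrow> ?c i < ?c j"
    using assms(2) by (auto simp: enumerates_along_def)
  have "p i \<in> P" "p j \<in> P" using bij assms(3,4) by (auto simp: bij_betw_def)
  \<comment> \<open>Equal points also fail \<open>visible\<close>, so this case is excluded before a
    blocker is extracted.\<close>
  moreover have "p i \<noteq> p j" using mono[OF assms(3-5)] by auto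
  ultimately obtain z where z: "z \<in> open_segment (p i) (p j)" "z \<in> P"
    using assms(6) by (auto simp: visible_def)
  then obtain m where m: "m \<in> {1..card P}" "z = p m"
    using bij_betw_imp_surj_on[OF bij] by blast
  have "?c i < ?c m" "?c m < ?c j"
    using closest_point_open_segment_less[OF L z(1) mono[OF assms(3-5)]] m(2) by auto
  then have "i < m" "m < j"
    using mono[OF m(1) assms(3)] mono[OF assms(4) m(1)] by (metis linorder_neqE_nat order_less_asym)+
  then show ?thesis using z(1) m(2) by blast
qed

theorem lemma3p1:
  fixes P L :: "(real^2) set" and p :: "nat \<Rightarrow> real^2" and n K :: nat
  assumes "finite P" and "card P = n"
    and "no_four_collinear P"
    and "nonvertical_line L"
    and "inj_on (closest_point L) P"
    and "enumerates_along L P p"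
    and "K \<ge> 1" and "2 * K \<le> n"
  shows "Q_bar P p (2 * K) \<le> int (Q P p K)"
proof -
  have bij: "bij_betw p {1..n} P" using assms(2,6) by (simp add: enumerates_along_def)
  then have inj: "inj_on p {1..n}" by (simp add: bij_betw_def)
  have inP: "p i \<in> P" if "1 \<le> i" "i \<le> n" for i using bij that by (auto simp: bij_betw_def)
  \<comment> \<open>With \<open>r \<le> n\<close> the subtraction is exact and the window stays
    inside \<open>{1..n}\<close>, where \<open>p\<close> is injective.\<close>
  have we: "window_edges P p r s = card (visible_pairs P p r s)"
    if "s \<in> {1..n - r + 1}" "r \<le> n" for r s
    by (rule window_edges_eq_card, rule inj_on_subset[OF inj]) (use that in auto)
  \<comment> \<open>Tagging each pair with the start of its window counts it once per window, as the
    two sums do.\<close>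
  define N where "N = Sigma {1..n - 2 * K + 1} (invisible_pairs P p (2 * K))"
  define V where "V = Sigma {1..n - K + 1} (visible_pairs P p K)"
  have "Q_bar P p (2 * K) = (\<Sum>s = 1..n - 2 * K + 1. int (card (invisible_pairs P p (2 * K) s)))"
    unfolding Q_bar_def assms(2) by (intro sum.cong) (use assms(8) in \<open>simp_all add: we card_invisible_pairs\<close>)
  also have "\<dots> = int (card N)" by (simp add: N_def card_SigmaI)
  finally have QN: "Q_bar P p (2 * K) = int (card N)" .
  have "Q P p K = (\<Sum>s = 1..n - K + 1. card (visible_pairs P p K s))"
    unfolding Q_def assms(2) by (intro sum.cong) (use assms(8) in \<open>simp_all add: we\<close>)
  also have "\<dots> = card V" by (simp add: V_def card_SigmaI)
  finally have QV: "Q P p K = card V" .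
  \<comment> \<open>The index of a blocker; the choice is meaningful on entries of \<open>N\<close>,
    by \<open>N_D\<close>.\<close>
  define b where "b i j = (SOME m. i < m \<and> m < j \<and> p m \<in> open_segment (p i) (p j))" for i j
  have N_D: "1 \<le> s" "s + 2 * K \<le> n + 1" "s \<le> i" "j < s + 2 * K" "i < b i j" "b i j < j"
    "p (b i j) \<in> open_segment (p i) (p j)" if "(s, i, j) \<in> N" for s i j
  proof -
    show *: "1 \<le> s" "s + 2 * K \<le> n + 1" "s \<le> i" "j < s + 2 * K"
      using that assms(8) by (auto simp: N_def invisible_pairs_def)
    have "i < j" "\<not> visible P (p i) (p j)" using that by (auto simp: N_def invisible_pairs_def)
    with * have "\<exists>m. i < m \<and> m < j \<and> p m \<in> open_segment (p i) (p j)"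
      by (intro ex_blocking_index[OF assms(4,6)]) (auto simp: assms(2))
    from someI_ex[OF this]
    show "i < b i j" "b i j < j" "p (b i j) \<in> open_segment (p i) (p j)"
      unfolding b_def by blast+
  qed
  have uniq: "k = l"
    if "{i, j, k, l} \<subseteq> {1..n}" "i \<noteq> j" "k \<notin> {i, j}" "l \<notin> {i, j}"
      "collinear {p i, p j, p k}" "collinear {p i, p j, p l}" for i j k l
  proof -
    have "p i \<noteq> p j" "p k \<notin> {p i, p j}" "p l \<notin> {p i, p j}"
      using that(1-4) inj_on_eq_iff[OF inj] by auto
    then have "p k = p l"
      using that(1,5,6) inP by (intro no_four_collinear_third_unique[OF assms(3)]) auto
    then show ?thesis using that(1) inj_on_eq_iff[OF inj] by auto
  qed
  \<comment> \<open>The first component is the start of the half used. It is at most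
    \<open>n - K + 1\<close>, since \<open>s + 2 * K \<le> n + 1\<close>.\<close>
  define f where "f = (\<lambda>(s, i, j). if b i j < s + K then (s, i, b i j) else (s + K, b i j, j))"
  have "f ` N \<subseteq> V"
  proof (rule image_subsetI, simp only: split_paired_all)
    fix s i j assume N: "(s, i, j) \<in> N"
    note d = N_D[OF N]
    have P: "p i \<in> P" "p j \<in> P" "p (b i j) \<in> P" using d by (auto intro: inP)
    have "visible P (p i) (p (b i j))"
      using P d(7) by (intro visible_blocking_point[OF assms(3)])
    moreover have "visible P (p (b i j)) (p j)"
      using P d(7) open_segment_commute visible_commute visible_blocking_point[OF assms(3)] by metis
    ultimately show "f (s, i, j) \<in> V"
      using d(1-6) by (auto simp: f_def V_def visible_pairs_def)
  qed
  moreover have "inj_on f N"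
  proof (rule inj_onI, simp only: split_paired_all)
    fix s i j s' i' j'
    assume N: "(s, i, j) \<in> N" and N': "(s', i', j') \<in> N" and eq: "f (s, i, j) = f (s', i', j')"
    note d = N_D[OF N] and d' = N_D[OF N']
    have c: "collinear {p i, p (b i j), p j}" "collinear {p i', p (b i' j'), p j'}"
      using d(7) d'(7) by (auto intro: open_segment_collinear)
    then have c2: "collinear {p (b i j), p j, p i}" "collinear {p (b i' j'), p j', p i'}"
      by (simp_all add: insert_commute)
    consider (left) "s = s'" "i = i'" "b i j = b i' j'"
      | (right) "s = s'" "b i j = b i' j'" "j = j'"
      | (left_right) "i = b i' j'" "b i j = j'"
      | (right_left) "i' = b i j" "b i' j' = j"
      using eq by (auto simp: f_def split: if_splits)
    then have "s = s' \<and> i = i' \<and> j = j'"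
    proof cases
      \<comment> \<open>When the same half is used, the tag recovers \<open>s\<close>, and the
        dropped endpoint is the unique third point on the line of the kept pair.\<close>
      case left
      then have "j = j'"
        using c d(1-6) d'(1-6) by (intro uniq[of i "b i j"]) auto
      then show ?thesis using left by simp
    next
      case right
      then have "i = i'"
        using c2 d(1-6) d'(1-6) by (intro uniq[of "b i j" j]) auto
      then show ?thesis using right by simp
    next
      \<comment> \<open>When opposite halves are used, uniqueness identifies the dropped endpoints
        \<open>j\<close> and \<open>i'\<close>, although
        \<open>i' < b i' j' = i < j\<close>.\<close>
      case left_right
      then have "j = i'"
        using c(1) c2(2) d(1-6) d'(1-6) by (intro uniq[of i "b i j"]) auto
      then show ?thesis using left_right d(5,6) d'(5) by simp
    next
      case right_left
      then have "j' = i"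
        using c(2) c2(1) d(1-6) d'(1-6) by (intro uniq[of i' "b i' j'"]) auto
      then show ?thesis using right_left d(5) d'(5,6) by simp
    qed
    then show "(s, i, j) = (s', i', j')" by simp
  qed
  moreover have "finite V" by (simp add: V_def)
  ultimately have "card N \<le> card V" by (intro card_inj_on_le[of f])
  then show ?thesis by (simp add: QN QV)
qed

end
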